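(* Let $f=\frac1N\sum_{i=1}^N f_i$ on $\mathbb{R}^{m\times n}$, the stochastic gradients $\nabla f_\xi$ (with variance bound $\sigma^2$), and the Muon iteration $(\bm{W}_t,\bm{M}_t,\bm{C}_t,\bm{O}_t)$ with learning rates $\eta_t>0$, batch sizes $b_t>0$ and momentum parameter $\beta\in[0,1)$ be as in the context. Suppose that the assumptions (i), (ii-1), (ii-2) stated there hold, and let $L:=\frac1N\sum_{i=1}^N L_i$ and $f^\star:=\inf_{\bm{W}\in\mathbb{R}^{m\times n}} f(\bm{W})$. Then the following hold. (i) Muon without Nesterov ($\bm{C}_t=\bm{M}_t$) satisfies that, for all $T\in\mathbb{N}$, $$\min_{t\in\{0,1,\dots,T-1\}}\mathbb{E}[\|\nabla f(\bm{W}_t)\|_{\mathrm F}]\le \frac{C_1}{\sum_{t=0}^{T-1}\eta_t}+C_2\frac{\sum_{t=0}^{T-1}\eta_t^2}{\sum_{t=0}^{T-1}\eta_t}+C_3\frac{\sum_{t=0}^{T-1}\eta_t\beta^t}{\sum_{t=0}^{T-1}\eta_t}+C_4\frac{\sum_{t=0}^{T-1}\eta_t\sum_{i=1}^t\beta^i\eta_{t-i}}{\sum_{t=0}^{T-1}\eta_t}+C_5\frac{\sum_{t=0}^{T-1}\eta_t\sum_{i=0}^t\frac{\beta^i}{\sqrt{b_{t-i}}}}{\sum_{t=0}^{T-1}\eta_t},$$ where $$C_1 := f(\bm{W}_0)-f^\star,\quad C_2:=\frac{nL}{2},\quad C_3:=2\,\|\bm{M}_0-\nabla f(\bm{W}_0)\|_{\mathrm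 F}\sqrt n,\quad C_4:=2nL,\quad C_5:=2(1-\beta)\sigma\sqrt n .$$ (ii) Muon with Nesterov ($\bm{C}_t=\beta\bm{M}_t+(1-\beta)\nabla f_{B_t}(\bm{W}_t)$) satisfies that, for all $T\in\mathbb{N}$, $$\min_{t\in\{0,1,\dots,T-1\}}\mathbb{E}[\|\nabla f(\bm{W}_t)\|_{\mathrm F}]\le \frac{C_1}{\sum_{t=0}^{T-1}\eta_t}+C_2\frac{\sum_{t=0}^{T-1}\eta_t^2}{\sum_{t=0}^{T-1}\eta_t}+C_3\frac{\sum_{t=0}^{T-1}\eta_t\beta^{t+1}}{\sum_{t=0}^{T-1}\eta_t}+C_4\frac{\sum_{t=0}^{T-1}\eta_t\sum_{i=1}^t\beta^{i+1}\eta_{t-i}}{\sum_{t=0}^{T-1}\eta_t}+C_5\frac{\sum_{t=0}^{T-1}\eta_t\sum_{i=0}^t\frac{\beta^{i+1}}{\sqrt{b_{t-i}}}}{\sum_{t=0}^{T-1}\eta_t}+C_6\frac{\sum_{t=0}^{T-1}\frac{\eta_t}{\sqrt{b_t}}}{\sum_{t=0}^{T-1}\eta_t},$$ where $C_1,\dots,C_5$ are defined as in (i) and $C_6:=2(1-\beta)\sigma\sqrt n$.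
   Context: Notation. $\mathbb{N}$ is the set of natural numbers $1,2,\dots$. $\mathbb{R}^{m\times n}$ is the set of $m\times n$ matrices with inner product $\bm{W}_1\bullet\bm{W}_2$ and Frobenius norm $\|\bm{W}\|_{\mathrm F}:=\sqrt{\bm{W}\bullet\bm{W}}$. $\mathbb{E}_\xi$ and $\mathbb{V}_\xi$ are expectation and variance with respect to a random variable $\xi$ (for a random matrix $\bm{G}$, $\mathbb{V}_\xi[\bm{G}]=\mathbb{E}_\xi[\|\bm{G}-\mathbb{E}_\xi[\bm{G}]\|_{\mathrm F}^2]$), and $\mathbb{E}$ is the total expectation. $\bm{I}_n$ is the $n\times n$ identity matrix. Problem. $f_1,\dots,f_N:\mathbb{R}^{m\times n}\to\mathbb{R}$ are differentiable (possibly nonconvex) loss functions, and $f(\bm{W}):=\frac1N\sum_{i=1}^N f_i(\bm{W})$. Assumptions. (i) Each $f_i$ is $L_i$-smooth: $\|\nabla f_i(\bm{W}_1)-\nabla f_i(\bm{W}_2)\|_{\mathrm F}\le L_i\|\bm{W}_1-\bm{W}_2\|_{\mathrm F}$ for all $\bm{W}_1,\bm{W}_2\in\mathbb{R}^{m\times n}$; and $f_i^\star:=\inf_{\bm{W}\in\mathbb{R}^{m\times n}}f_i(\bm{W})$ is finite. (ii) $\xi$ is a random variable independent of $\bm{W}\in\mathbb{R}^{m\times n}$, and $\nabla f_\xi:\mathbb{R}^{m\times n}\to\mathbb{R}^{m\times n}$ is the stochastic gradient of $f$ such that (ii-1) $\mathbb{E}_\xi[\nabla f_\xi(\bm{W})]=\nabla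 f(\bm{W})$ for all $\bm{W}\in\mathbb{R}^{m\times n}$; (ii-2) there exists $\sigma\ge0$ such that $\mathbb{V}_\xi[\nabla f_\xi(\bm{W})]\le\sigma^2$ for all $\bm{W}\in\mathbb{R}^{m\times n}$. Muon algorithm. Given $\eta_t>0$, batch sizes $b_t>0$, $\beta\in[0,1)$, $\bm{M}_{-1}:=\bm{O}$ (the zero matrix), $\bm{W}_0\in\mathbb{R}^{m\times n}$ and $T\in\mathbb{N}$, for $t=0,1,\dots,T-1$: $\nabla f_{B_t}(\bm{W}_t):=\frac1{b_t}\sum_{i=1}^{b_t}\nabla f_{\xi_{t,i}}(\bm{W}_t)$; $\bm{M}_t:=\beta\bm{M}_{t-1}+(1-\beta)\nabla f_{B_t}(\bm{W}_t)$; $\bm{C}_t:=\beta\bm{M}_t+(1-\beta)\nabla f_{B_t}(\bm{W}_t)$ ("with Nesterov") or $\bm{C}_t:=\bm{M}_t$ ("without Nesterov"); $\bm{O}_t:=\operatorname{argmin}\{\|\bm{O}-\bm{C}_t\|_{\mathrm F}:\bm{O}^\top\bm{O}=\bm{I}_n\}$ (over $\bm{O}\in\mathbb{R}^{m\times n}$); $\bm{W}_{t+1}:=\bm{W}_t-\eta_t\bm{O}_t$. Here $\bm{\xi}_t=(\xi_{t,1},\dots,\xi_{t,b_t})^\top$ comprises $b_t$ independent and identically distributed variables (copies of $\xi$) and is independent of $\bm{W}\in\mathbb{R}^{m\times n}$.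
   Formalization: The printed constant C_3 contains M_0, which depends on the random first batch, so it is not a number; the formal statement uses its total expectation, C_3 = 2 E[||M_0 - grad f(W_0)||_F] sqrt(n), which agrees with the printed formula whenever M_0 is not random. *)

theory Defs
  imports "HOL-Analysis.Analysis" "HOL-Probability.Probability"
begin

text \<open>
  An \<open>m \<times> n\<close> matrix is an element of \<^typ>\<open>real ^ 'n ^ 'm\<close>, with \<open>m = CARD('m)\<close> and
  \<open>n = CARD('n)\<close>.  On this type the library's inner product is the entrywise one, so that
  \<^const>\<open>norm\<close> is the Frobenius norm.
\<close>

text \<open>Only meaningful at points where \<open>f\<close> is differentiable.\<close>

definition gradient :: "('a::real_inner \<Rightarrow> real) \<Rightarrow> 'a \<Rightarrow> 'a" where
  "gradient f x = (THE D. GDERIV f x :> D)"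

definition smooth_with :: "real \<Rightarrow> ('a::real_inner \<Rightarrow> real) \<Rightarrow> bool" where
  "smooth_with L f \<longleftrightarrow>
     (\<forall>x. f differentiable (at x)) \<and>
     (\<forall>x y. norm (gradient f x - gradient f y) \<le> L * norm (x - y))"

text \<open>
  The variance of a random vector or matrix, with values in \<open>[0, \<infinity>]\<close>: a finite bound on it
  then includes square integrability, whereas a Bochner integral would be \<open>0\<close> for a
  non-integrable integrand.
\<close>

definition total_variance ::
    "'s measure \<Rightarrow> ('s \<Rightarrow> 'a::{real_inner,banach,second_countable_topology}) \<Rightarrow> ennreal" where
  "total_variance D X =
     (\<integral>\<^sup>+ s. ennreal ((norm (X s - (\<integral>r. X r \<partial>D)))\<^sup>2) \<partial>D)"

text \<open>
  Independence of two random variables; the library's \<open>indep_var\<close> requires both to have the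
  same type of values.
\<close>

definition independent_rvs ::
    "'w measure \<Rightarrow> 'a measure \<Rightarrow> ('w \<Rightarrow> 'a) \<Rightarrow> 'b measure \<Rightarrow> ('w \<Rightarrow> 'b) \<Rightarrow> bool" where
  "independent_rvs \<Omega> A X B Y \<longleftrightarrow>
     X \<in> measurable \<Omega> A \<and> Y \<in> measurable \<Omega> B \<and>
     prob_space.indep_set \<Omega>
       {X -` S \<inter> space \<Omega> |S. S \<in> sets A} {Y -` S \<inter> space \<Omega> |S. S \<in> sets B}"

text \<open>
  \<open>G s V\<close> is the stochastic gradient at the point \<open>V\<close> for the sample \<open>s\<close>; the batch is
  \<open>\<xi> 1, \<dots>, \<xi> b\<close>.
\<close>

definition minibatch_gradient ::
    "('s \<Rightarrow> 'a \<Rightarrow> 'a::real_vector) \<Rightarrow> nat \<Rightarrow> (nat \<Rightarrow> 's) \<Rightarrow> 'a \<Rightarrow> 'a" where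
  "minibatch_gradient G b \<xi> V = (1 / real b) *\<^sub>R (\<Sum>i=1..b. G (\<xi> i) V)"

text \<open>
  \<open>X\<close> is a minimiser; the minimiser is not unique if \<open>C\<close> does not have full column rank, and
  there is none if \<open>m < n\<close>.
\<close>

definition is_orthogonalization :: "real ^ 'n ^ 'm \<Rightarrow> real ^ 'n ^ 'm \<Rightarrow> bool" where
  "is_orthogonalization C X \<longleftrightarrow>
     is_arg_min (\<lambda>Y. norm (Y - C)) (\<lambda>Y. transpose Y ** Y = mat 1) X"

end

theory Submission
  imports Defs
begin

text \<open>
  A step along the orthogonalized direction \<open>O\<close> decreases an \<open>L\<close>-smooth \<open>f\<close> to first order by
  \<open>\<eta> (O \<bullet> \<nabla>f)\<close>, and \<open>O\<close> has norm \<open>sqrt n\<close>.  Among matrices with orthonormal columns, \<open>O\<close>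
  maximizes the inner product with \<open>C\<close>, and the maximum (the nuclear norm of \<open>C\<close>) is at least the
  Frobenius norm of \<open>C\<close>: this is \<open>norm_le_inner_orthogonalization\<close>.  So \<open>O \<bullet> \<nabla>f\<close> is at least
  \<open>\<parallel>\<nabla>f\<parallel>\<close> up to a multiple of the direction error \<open>\<parallel>C - \<nabla>f\<parallel>\<close>, and the descent lemma bounds
  \<open>\<eta> \<parallel>\<nabla>f\<parallel>\<close> by the decrease of \<open>f\<close> plus a term in \<open>\<eta>\<^sup>2\<close> plus a multiple of \<open>\<eta> \<parallel>C - \<nabla>f\<parallel>\<close>
  (\<open>muon_step\<close>).  Taking expectations and summing, the values of \<open>f\<close> telescope, and the smallest
  expected gradient norm is at most the average weighted by the learning rates
  (\<open>min_expected_gradient_norm_le\<close>).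

  It remains to bound the expected direction error.  The momentum error obeys the recursion
  \<open>e\<^sub>t = \<beta> e\<^sub>t\<^sub>-\<^sub>1 + \<beta> (\<nabla>f(W\<^sub>t\<^sub>-\<^sub>1) - \<nabla>f(W\<^sub>t)) + (1 - \<beta>) \<delta>\<^sub>t\<close>, where \<open>\<delta>\<^sub>t\<close> is the minibatch noise.
  The drift is at most \<open>L sqrt n \<eta>\<^sub>t\<^sub>-\<^sub>1\<close> because every \<open>O\<close> has norm \<open>sqrt n\<close>, and
  \<open>E \<parallel>\<delta>\<^sub>t\<parallel> \<le> \<sigma> / sqrt b\<^sub>t\<close> because the batch averages \<open>b\<^sub>t\<close> independent unbiased samples drawn
  independently of \<open>W\<^sub>t\<close> (\<open>minibatch_gradient_error\<close>).  Unrolling the recursion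
  (\<open>momentum_error\<close>) gives the sums in \<open>\<beta>\<close>.  With Nesterov, the direction error is the convex
  combination \<open>\<beta> e\<^sub>t + (1 - \<beta>) \<delta>\<^sub>t\<close>.
\<close>

section \<open>Orthogonalization\<close>

lemma transpose_mult_self_nth:
  fixes X :: "real ^ 'n ^ 'm"
  shows "(transpose X ** X) $ k $ l = (\<Sum>i\<in>UNIV. X $ i $ k * X $ i $ l)"
  by (simp add: matrix_matrix_mult_def transpose_def)

lemma norm_orthonormal_columns:
  fixes X :: "real ^ 'n ^ 'm"
  assumes "transpose X ** X = mat 1"
  shows "norm X = sqrt (real CARD('n))"
proof -
  have "X \<bullet> X = (\<Sum>i\<in>UNIV. \<Sum>k\<in>UNIV. X $ i $ k * X $ i $ k)"
    by (simp add: inner_vec_def)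
  also have "\<dots> = (\<Sum>k\<in>UNIV. (transpose X ** X) $ k $ k)"
    unfolding transpose_mult_self_nth by (rule sum.swap)
  also have "\<dots> = real CARD('n)"
    by (simp add: assms mat_def)
  finally show ?thesis
    by (simp add: norm_eq_sqrt_inner)
qed

lemma norm_orthonormal_columns_mult:
  fixes X :: "real ^ 'n ^ 'm"
  assumes "transpose X ** X = mat 1"
  shows "norm (X *v x) = norm x"
proof -
  have "(X *v x) \<bullet> (X *v x) = (transpose X *v (X *v x)) \<bullet> x"
    by (metis dot_lmul_matrix inner_commute transpose_matrix_vector)
  also have "\<dots> = x \<bullet> x"
    by (simp add: matrix_vector_mul_assoc assms)
  finally show ?thesis
    by (simp add: norm_eq_sqrt_inner)
qed

lemma orthogonalization_columns:
  "is_orthogonalization C X \<Longrightarrow> transpose X ** X = mat 1"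
  by (simp add: is_orthogonalization_def is_arg_min_def)

text \<open>
  In \<open>\<parallel>Y - C\<parallel>\<^sup>2 = \<parallel>Y\<parallel>\<^sup>2 - 2 (Y \<bullet> C) + \<parallel>C\<parallel>\<^sup>2\<close> only the middle term varies, as all matrices with
  orthonormal columns have the same norm.
\<close>

lemma orthogonalization_maximizes_inner:
  fixes C X Y :: "real ^ 'n ^ 'm"
  assumes "is_orthogonalization C X" and Y: "transpose Y ** Y = mat 1"
  shows "Y \<bullet> C \<le> X \<bullet> C"
proof -
  have X: "transpose X ** X = mat 1" and min: "norm (X - C) \<le> norm (Y - C)"
    using assms by (auto simp: is_orthogonalization_def is_arg_min_def not_less)
  have "(norm (X - C))\<^sup>2 \<le> (norm (Y - C))\<^sup>2"
    using min by (simp add: power_mono)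
  moreover have "X \<bullet> X = Y \<bullet> Y"
    using norm_orthonormal_columns[OF X] norm_orthonormal_columns[OF Y]
    by (simp add: norm_eq_sqrt_inner)
  ultimately show ?thesis
    by (simp add: power2_norm_eq_inner inner_diff inner_commute)
qed

lemma sum_pair_split:
  fixes h :: "'m::finite \<Rightarrow> 'a::comm_monoid_add"
  assumes "i \<noteq> j"
  shows "(\<Sum>r\<in>UNIV. h r) = h i + h j + (\<Sum>r\<in>UNIV - {i,j}. h r)"
proof -
  have "(\<Sum>r\<in>UNIV. h r) = (\<Sum>r\<in>{i,j}. h r) + (\<Sum>r\<in>UNIV - {i,j}. h r)"
    by (subst sum.subset_diff[of "{i,j}"]) (auto simp: add.commute)
  then show ?thesis
    using assms by simp
qed

lemma linear_on_circle_bound: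
  fixes p q r :: real
  assumes "\<And>c s. c\<^sup>2 + s\<^sup>2 = 1 \<Longrightarrow> c * p + s * q \<le> r"
  shows "p\<^sup>2 + q\<^sup>2 \<le> r\<^sup>2"
proof (cases "p = 0 \<and> q = 0")
  case False
  define z where "z = sqrt (p\<^sup>2 + q\<^sup>2)"
  have z: "z > 0" "z\<^sup>2 = p\<^sup>2 + q\<^sup>2"
    using False by (auto simp: z_def sum_power2_gt_zero_iff)
  \<comment> \<open>The linear form attains its maximum \<open>z\<close> in the direction of \<open>(p, q)\<close>.\<close>
  have "(p / z)\<^sup>2 + (q / z)\<^sup>2 = 1"
    using z(1) by (simp add: power_divide add_divide_distrib[symmetric] flip: z(2))
  from assms[OF this] have "(p * p + q * q) / z \<le> r"
    by (simp add: add_divide_distrib)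
  moreover have "(p * p + q * q) / z = z"
    using z by (simp add: power2_eq_square field_simps)
  ultimately have "z \<le> r"
    by simp
  then have "z\<^sup>2 \<le> r\<^sup>2"
    using z(1) by (intro power_mono) auto
  then show ?thesis
    by (simp add: z(2))
qed simp

text \<open>
  Multiplication from the left by an orthogonal matrix preserves orthonormality of the columns.
  The competitor used here applies a rotation (\<open>e = 1\<close>) or a reflection (\<open>e = -1\<close>) to the rows
  \<open>i\<close> and \<open>j\<close> of \<open>X\<close>.
\<close>

lemma orthogonalization_row_pair:
  fixes C X :: "real ^ 'n ^ 'm"
  assumes orth: "is_orthogonalization C X" and ij: "i \<noteq> j"
    and cs: "c\<^sup>2 + s\<^sup>2 = 1" and e: "e\<^sup>2 = 1"
  shows "c * (C $ i \<bullet> X $ i + e * (C $ j \<bullet> X $ j)) + s * (C $ i \<bullet> X $ j - e * (C $ j \<bullet> X $ i))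
    \<le> C $ i \<bullet> X $ i + C $ j \<bullet> X $ j"
proof -
  define Y :: "real ^ 'n ^ 'm" where
    "Y = (\<chi> r. if r = i then c *\<^sub>R X $ i + s *\<^sub>R X $ j
               else if r = j then e *\<^sub>R (c *\<^sub>R X $ j - s *\<^sub>R X $ i) else X $ r)"
  have "transpose Y ** Y = mat 1"
  proof -
    have "(\<Sum>r\<in>UNIV. Y $ r $ k * Y $ r $ l) = (\<Sum>r\<in>UNIV. X $ r $ k * X $ r $ l)" for k l
    proof -
      have "Y $ i $ k * Y $ i $ l + Y $ j $ k * Y $ j $ l
          = (c\<^sup>2 + s\<^sup>2 * e\<^sup>2) * (X $ i $ k * X $ i $ l) + (s\<^sup>2 + c\<^sup>2 * e\<^sup>2) * (X $ j $ k * X $ j $ l)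
            + c * s * (1 - e\<^sup>2) * (X $ i $ k * X $ j $ l + X $ j $ k * X $ i $ l)"
        using ij by (simp add: Y_def algebra_simps power2_eq_square)
      also have "\<dots> = X $ i $ k * X $ i $ l + X $ j $ k * X $ j $ l"
        using cs by (simp add: e add.commute)
      finally show ?thesis
        unfolding sum_pair_split[OF ij] by (simp add: Y_def)
    qed
    then show ?thesis
      using orthogonalization_columns[OF orth]
      by (simp add: vec_eq_iff transpose_mult_self_nth)
  qed
  then have "Y \<bullet> C \<le> X \<bullet> C"
    by (rule orthogonalization_maximizes_inner[OF orth])
  then show ?thesis
    unfolding inner_vec_def[where 'b='m] sum_pair_split[OF ij] using ij
    by (simp add: Y_def inner_add inner_diff inner_commute algebra_simps)
qed

text \<open>
  The matrix \<open>K = C X\<^sup>T\<close> has trace \<open>X \<bullet> C\<close> and the same norm as \<open>C\<close>.  For each pair \<open>i, j\<close>,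
  optimality of \<open>X\<close> against rotations and against reflections of two rows gives two bounds whose sum
  is \<open>K\<^sub>i\<^sub>j\<^sup>2 + K\<^sub>j\<^sub>i\<^sup>2 \<le> 2 K\<^sub>i\<^sub>i K\<^sub>j\<^sub>j\<close>; summing over all pairs yields \<open>\<parallel>K\<parallel>\<^sup>2 \<le> (tr K)\<^sup>2\<close>.  This replaces
  an appeal to the singular value decomposition.
\<close>

lemma norm_le_inner_orthogonalization:
  fixes C X :: "real ^ 'n ^ 'm"
  assumes orth: "is_orthogonalization C X"
  shows "norm C \<le> X \<bullet> C"
proof -
  define K where "K i j = C $ i \<bullet> X $ j" for i j
  have pair: "(K i j)\<^sup>2 + (K j i)\<^sup>2 \<le> 2 * (K i i * K j j)" for i j
  proof (cases "i = j")
    case False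
    have "(K i i + e * K j j)\<^sup>2 + (K i j - e * K j i)\<^sup>2 \<le> (K i i + K j j)\<^sup>2" if "e\<^sup>2 = 1" for e
      using orthogonalization_row_pair[OF orth False _ that] linear_on_circle_bound by (simp add: K_def)
    from this[of 1] this[of "-1"] show ?thesis
      by (simp add: power2_eq_square algebra_simps)
  qed (simp add: power2_eq_square)
  have "(norm C)\<^sup>2 = (\<Sum>i\<in>UNIV. (norm (X *v C $ i))\<^sup>2)"
    by (simp add: norm_orthonormal_columns_mult[OF orthogonalization_columns[OF orth]]
        power2_norm_eq_inner inner_vec_def[where 'b='m])
  also have "\<dots> = (\<Sum>i\<in>UNIV. \<Sum>j\<in>UNIV. (K i j)\<^sup>2)"
    unfolding power2_norm_eq_inner
    by (simp add: inner_vec_def[where 'b='m] matrix_vector_mul_component K_def inner_commute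
        power2_eq_square)
  also have "\<dots> = (\<Sum>i\<in>UNIV. \<Sum>j\<in>UNIV. ((K i j)\<^sup>2 + (K j i)\<^sup>2) / 2)"
    using sum.swap[of "\<lambda>i j. (K i j)\<^sup>2" UNIV UNIV]
    by (simp add: add_divide_distrib sum.distrib flip: sum_divide_distrib)
  also have "\<dots> \<le> (\<Sum>i\<in>UNIV. \<Sum>j\<in>UNIV. K i i * K j j)"
    using pair by (intro sum_mono) (simp add: field_simps)
  also have "\<dots> = (X \<bullet> C)\<^sup>2"
    by (simp add: power2_eq_square sum_product inner_vec_def[where 'b='m] K_def inner_commute)
  finally have "(norm C)\<^sup>2 \<le> (X \<bullet> C)\<^sup>2" .
  moreover have "0 \<le> X \<bullet> C"
  proof -
    \<comment> \<open>The squared inequality leaves the sign of the trace open; the competitor \<open>- X\<close> settles it.\<close>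
    have "transpose (- X) ** (- X) = mat 1"
      using orthogonalization_columns[OF orth]
      by (simp add: vec_eq_iff transpose_mult_self_nth)
    from orthogonalization_maximizes_inner[OF orth this] show ?thesis
      by simp
  qed
  ultimately show ?thesis
    by (simp add: power2_le_iff_abs_le abs_of_nonneg)
qed

section \<open>Smooth functions\<close>

lemma gradient_eqI:
  assumes D: "GDERIV f x :> d"
  shows "gradient f x = d"
proof -
  have "e = d" if "GDERIV f x :> e" for e
  proof -
    have "(\<lambda>h. h \<bullet> e) = (\<lambda>h. h \<bullet> d)"
      using that D unfolding gderiv_def by (rule has_derivative_unique)
    then have "(e - d) \<bullet> e = (e - d) \<bullet> d"
      by (rule fun_cong)
    then have "(e - d) \<bullet> (e - d) = 0"
      by (simp add: inner_diff_right)
    then show ?thesis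
      by simp
  qed
  with D show ?thesis
    unfolding gradient_def by blast
qed

lemma smooth_with_GDERIV:
  fixes f :: "'a::euclidean_space \<Rightarrow> real"
  assumes "smooth_with L f"
  shows "GDERIV f x :> gradient f x"
proof -
  obtain f' where f': "(f has_derivative f') (at x)"
    using assms unfolding smooth_with_def differentiable_def by blast
  \<comment> \<open>The vector that represents the linear functional \<open>f'\<close> by the inner product.\<close>
  define d where "d = (\<Sum>i\<in>Basis. f' i *\<^sub>R i)"
  interpret f': bounded_linear f'
    using f' by (rule has_derivative_bounded_linear)
  have "f' h = h \<bullet> d" for h
  proof -
    have "f' h = f' (\<Sum>i\<in>Basis. (h \<bullet> i) *\<^sub>R i)"
      by (simp add: euclidean_representation)
    also have "\<dots> = h \<bullet> d"
      by (simp add: d_def f'.sum f'.scaleR inner_sum_right mult.commute)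
    finally show ?thesis .
  qed
  then have "f' = (\<lambda>h. h \<bullet> d)"
    by (rule ext)
  with f' have "GDERIV f x :> d"
    by (simp add: gderiv_def)
  then show ?thesis
    using gradient_eqI by metis
qed

lemma smooth_with_average:
  fixes fs :: "nat \<Rightarrow> 'a::euclidean_space \<Rightarrow> real"
  assumes "N \<ge> 1" and smooth: "\<And>i. i \<in> {1..N} \<Longrightarrow> smooth_with (Ls i) (fs i)"
  shows "smooth_with ((1 / real N) * (\<Sum>i=1..N. Ls i)) (\<lambda>x. (1 / real N) * (\<Sum>i=1..N. fs i x))"
    (is "smooth_with ?L ?f")
proof -
  define h where "h x = (1 / real N) *\<^sub>R (\<Sum>i=1..N. gradient (fs i) x)" for x
  have D: "GDERIV ?f x :> h x" for x
  proof -
    have "(fs i has_derivative (\<lambda>y. y \<bullet> gradient (fs i) x)) (at x)" if "i \<in> {1..N}" for i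
      using smooth_with_GDERIV[OF smooth[OF that]] by (simp add: gderiv_def)
    then have "(?f has_derivative (\<lambda>y. (1 / real N) * (\<Sum>i=1..N. y \<bullet> gradient (fs i) x))) (at x)"
      by (intro has_derivative_mult_right has_derivative_sum) auto
    then show ?thesis
      by (simp add: gderiv_def h_def inner_sum_right)
  qed
  have "norm (h x - h y) \<le> ?L * norm (x - y)" for x y
  proof -
    have "norm (h x - h y) = (1 / real N) * norm (\<Sum>i=1..N. gradient (fs i) x - gradient (fs i) y)"
      by (simp add: h_def sum_subtractf flip: scaleR_diff_right)
    also have "\<dots> \<le> (1 / real N) * (\<Sum>i=1..N. Ls i * norm (x - y))"
      using smooth by (intro mult_left_mono sum_norm_le) (auto simp: smooth_with_def)
    finally show ?thesis
      by (simp add: sum_distrib_right)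
  qed
  then show ?thesis
    using D gradient_eqI[OF D] by (auto simp: smooth_with_def gderiv_def differentiable_def)
qed

lemma smooth_with_nonneg:
  fixes f :: "'a::euclidean_space \<Rightarrow> real"
  assumes "smooth_with L f"
  shows "0 \<le> L"
proof -
  obtain e :: 'a where e: "e \<in> Basis"
    using nonempty_Basis by blast
  have "0 \<le> norm (gradient f e - gradient f 0)"
    by simp
  also have "\<dots> \<le> L * norm (e - 0)"
    using assms unfolding smooth_with_def by blast
  finally show ?thesis
    using e by simp
qed

lemma continuous_on_smooth_with:
  fixes f :: "'a::euclidean_space \<Rightarrow> real"
  assumes "smooth_with L f"
  shows "continuous_on UNIV f"
  using assms
  by (auto simp: smooth_with_def intro!: continuous_at_imp_continuous_on
      differentiable_imp_continuous_within)

lemma continuous_on_gradient: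
  fixes f :: "'a::euclidean_space \<Rightarrow> real"
  assumes "smooth_with L f"
  shows "continuous_on UNIV (gradient f)"
proof -
  have "L-lipschitz_on UNIV (gradient f)"
    using assms smooth_with_nonneg[OF assms]
    by (auto simp: smooth_with_def dist_norm intro!: lipschitz_onI)
  then show ?thesis
    by (rule lipschitz_on_continuous_on)
qed

text \<open>
  Along the segment from \<open>x\<close> to \<open>y\<close>, subtracting from \<open>f\<close> the linear term and the quadratic
  term leaves a function whose derivative is nonpositive by the Lipschitz bound on the gradient.
\<close>

lemma descent_lemma:
  fixes f :: "'a::euclidean_space \<Rightarrow> real"
  assumes "smooth_with L f"
  shows "f y \<le> f x + gradient f x \<bullet> (y - x) + L / 2 * (norm (y - x))\<^sup>2"
proof -
  define v where "v = y - x"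
  define \<phi> where "\<phi> t = f (x + t *\<^sub>R v) - t * (gradient f x \<bullet> v) - L / 2 * (norm v)\<^sup>2 * t\<^sup>2"
    for t :: real
  have "\<phi> 1 \<le> \<phi> 0"
  proof (rule DERIV_nonpos_imp_nonincreasing[of 0 1 \<phi>])
    fix t :: real assume t: "0 \<le> t" "t \<le> 1"
    define q where "q = (gradient f (x + t *\<^sub>R v) - gradient f x) \<bullet> v - L * (norm v)\<^sup>2 * t"
    have "(f has_derivative (\<lambda>h. h \<bullet> gradient f (x + t *\<^sub>R v))) (at (x + t *\<^sub>R v))"
      using smooth_with_GDERIV[OF assms] by (simp add: gderiv_def)
    then have "((\<lambda>t. f (x + t *\<^sub>R v)) has_derivative
        (\<lambda>h. (h *\<^sub>R v) \<bullet> gradient f (x + t *\<^sub>R v))) (at t)"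
      by (rule has_derivative_compose[rotated]) (auto intro!: derivative_eq_intros)
    then have "((\<lambda>t. f (x + t *\<^sub>R v)) has_real_derivative gradient f (x + t *\<^sub>R v) \<bullet> v) (at t)"
      by (simp add: has_field_derivative_def inner_commute mult_commute_abs)
    then have "(\<phi> has_real_derivative q) (at t)"
      unfolding \<phi>_def q_def
      by (auto intro!: derivative_eq_intros simp: inner_diff_left algebra_simps)
    moreover have "q \<le> 0"
    proof -
      have "(gradient f (x + t *\<^sub>R v) - gradient f x) \<bullet> v
          \<le> norm (gradient f (x + t *\<^sub>R v) - gradient f x) * norm v"
        by (rule norm_cauchy_schwarz)
      also have "\<dots> \<le> (L * norm (x + t *\<^sub>R v - x)) * norm v"
        using assms by (intro mult_right_mono) (auto simp only: smooth_with_def norm_ge_zero)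
      finally show ?thesis
        using t by (simp add: q_def power2_eq_square mult_ac)
    qed
    ultimately show "\<exists>q. (\<phi> has_real_derivative q) (at t) \<and> q \<le> 0"
      by blast
  qed simp
  then show ?thesis
    by (simp add: \<phi>_def v_def)
qed

section \<open>Minibatch error\<close>

lemma pair_measure_eq_distr_if_independent:
  assumes "prob_space \<Omega>" and indep: "independent_rvs \<Omega> A X B Y"
  shows "distr \<Omega> A X \<Otimes>\<^sub>M distr \<Omega> B Y = distr \<Omega> (A \<Otimes>\<^sub>M B) (\<lambda>\<omega>. (X \<omega>, Y \<omega>))"
proof -
  interpret prob_space \<Omega> by fact
  have [measurable]: "X \<in> measurable \<Omega> A" "Y \<in> measurable \<Omega> B"
    using indep by (auto simp: independent_rvs_def)
  interpret X: prob_space "distr \<Omega> A X" by (rule prob_space_distr) simp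
  interpret Y: prob_space "distr \<Omega> B Y" by (rule prob_space_distr) simp
  show ?thesis
  proof (rule pair_measure_eqI)
    fix S T assume "S \<in> sets (distr \<Omega> A X)" "T \<in> sets (distr \<Omega> B Y)"
    then have [measurable]: "S \<in> sets A" "T \<in> sets B"
      by auto
    have "prob ((X -` S \<inter> space \<Omega>) \<inter> (Y -` T \<inter> space \<Omega>))
        = prob (X -` S \<inter> space \<Omega>) * prob (Y -` T \<inter> space \<Omega>)"
      using indep by (intro indep_setD) (auto simp: independent_rvs_def)
    moreover have "(X -` S \<inter> space \<Omega>) \<inter> (Y -` T \<inter> space \<Omega>)
        = (\<lambda>\<omega>. (X \<omega>, Y \<omega>)) -` (S \<times> T) \<inter> space \<Omega>"
      by auto
    ultimately show "emeasure (distr \<Omega> A X) S * emeasure (distr \<Omega> B Y) T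
        = emeasure (distr \<Omega> (A \<Otimes>\<^sub>M B) (\<lambda>\<omega>. (X \<omega>, Y \<omega>))) (S \<times> T)"
      by (simp add: emeasure_distr emeasure_eq_measure ennreal_mult)
  qed (simp_all add: X.sigma_finite_measure_axioms Y.sigma_finite_measure_axioms
      cong: sets_pair_measure_cong)
qed

text \<open>
  By Fubini on the product of the two distributions, a bound on the integral with \<open>X\<close> frozen at
  an arbitrary value carries over to random \<open>X\<close>, provided that \<open>X\<close> and \<open>Y\<close> are independent.
\<close>

lemma (in prob_space) nn_integral_independent:
  assumes indep: "independent_rvs M A X B Y"
    and h[measurable]: "h \<in> borel_measurable (A \<Otimes>\<^sub>M B)"
    and bound: "\<And>x. x \<in> space A \<Longrightarrow> (\<integral>\<^sup>+ \<omega>. h (x, Y \<omega>) \<partial>M) \<le> c"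
  shows "(\<integral>\<^sup>+ \<omega>. h (X \<omega>, Y \<omega>) \<partial>M) \<le> c"
proof -
  have [measurable]: "X \<in> measurable M A" "Y \<in> measurable M B"
    using indep by (auto simp: independent_rvs_def)
  interpret X: prob_space "distr M A X" by (rule prob_space_distr) simp
  interpret Y: prob_space "distr M B Y" by (rule prob_space_distr) simp
  have "(\<integral>\<^sup>+ \<omega>. h (X \<omega>, Y \<omega>) \<partial>M) = (\<integral>\<^sup>+ z. h z \<partial>(distr M A X \<Otimes>\<^sub>M distr M B Y))"
    by (simp add: pair_measure_eq_distr_if_independent[OF prob_space_axioms indep] nn_integral_distr)
  also have "\<dots> = (\<integral>\<^sup>+ x. \<integral>\<^sup>+ y. h (x, y) \<partial>distr M B Y \<partial>distr M A X)"
    by (rule Y.nn_integral_fst[symmetric]) simp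
  also have "\<dots> \<le> (\<integral>\<^sup>+ x. c \<partial>distr M A X)"
    using bound by (intro nn_integral_mono) (simp add: nn_integral_distr)
  also have "\<dots> = c"
    using X.emeasure_space_1 by simp
  finally show ?thesis .
qed

lemma (in prob_space) expectation_inner_indep:
  fixes X Y :: "'a \<Rightarrow> 'b::euclidean_space"
  assumes indep: "indep_var borel X borel Y" and int: "integrable M X" "integrable M Y"
  shows "integrable M (\<lambda>\<omega>. X \<omega> \<bullet> Y \<omega>)" (is ?int)
    and "expectation (\<lambda>\<omega>. X \<omega> \<bullet> Y \<omega>) = expectation X \<bullet> expectation Y" (is ?eq)
proof -
  have indep': "indep_var borel (\<lambda>\<omega>. X \<omega> \<bullet> e) borel (\<lambda>\<omega>. Y \<omega> \<bullet> e)" for e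
    using indep_var_compose[OF indep, of "\<lambda>x. x \<bullet> e" borel "\<lambda>x. x \<bullet> e" borel]
    by (simp add: comp_def)
  have eq: "X \<omega> \<bullet> Y \<omega> = (\<Sum>e\<in>Basis. (X \<omega> \<bullet> e) * (Y \<omega> \<bullet> e))" for \<omega>
    by (rule euclidean_inner)
  have *: "integrable M (\<lambda>\<omega>. (X \<omega> \<bullet> e) * (Y \<omega> \<bullet> e))"
      "expectation (\<lambda>\<omega>. (X \<omega> \<bullet> e) * (Y \<omega> \<bullet> e)) = (expectation X \<bullet> e) * (expectation Y \<bullet> e)" for e
    using indep_var_integrable[OF indep'] indep_var_lebesgue_integral[OF indep'] int by auto
  show ?int
    unfolding eq using * by auto
  have "expectation (\<lambda>\<omega>. X \<omega> \<bullet> Y \<omega>) = (\<Sum>e\<in>Basis. (expectation X \<bullet> e) * (expectation Y \<bullet> e))"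
    unfolding eq using * by simp
  also have "\<dots> = expectation X \<bullet> expectation Y"
    by (rule euclidean_inner[symmetric])
  finally show ?eq .
qed

text \<open>
  The expected inner products of distinct summands vanish, so only the diagonal contributes.  The
  second moments are integrals of nonnegative functions: their finiteness is what makes the
  Bochner integrals in the expansion meaningful.
\<close>

lemma (in prob_space) second_moment_sum_indep:
  fixes Z :: "'i \<Rightarrow> 'a \<Rightarrow> 'b::euclidean_space"
  assumes I: "finite I" and indep: "indep_vars (\<lambda>_. borel) Z I"
    and int: "\<And>i. i \<in> I \<Longrightarrow> integrable M (Z i)"
    and mean: "\<And>i. i \<in> I \<Longrightarrow> expectation (Z i) = 0"
    and var: "\<And>i. i \<in> I \<Longrightarrow> (\<integral>\<^sup>+ \<omega>. ennreal ((norm (Z i \<omega>))\<^sup>2) \<partial>M) \<le> ennreal v"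
    and v: "0 \<le> v"
  shows "(\<integral>\<^sup>+ \<omega>. ennreal ((norm (\<Sum>i\<in>I. Z i \<omega>))\<^sup>2) \<partial>M) \<le> ennreal (real (card I) * v)"
proof -
  have sq: "integrable M (\<lambda>\<omega>. Z i \<omega> \<bullet> Z i \<omega>)" "expectation (\<lambda>\<omega>. Z i \<omega> \<bullet> Z i \<omega>) \<le> v"
    if i: "i \<in> I" for i
  proof -
    have [measurable]: "Z i \<in> borel_measurable M"
      using int[OF i] by auto
    have fin: "(\<integral>\<^sup>+ \<omega>. ennreal (Z i \<omega> \<bullet> Z i \<omega>) \<partial>M) \<le> ennreal v"
      using var[OF i] by (simp add: power2_norm_eq_inner)
    then show 1: "integrable M (\<lambda>\<omega>. Z i \<omega> \<bullet> Z i \<omega>)"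
      by (intro integrableI_nonneg) (auto simp: le_less_trans)
    show "expectation (\<lambda>\<omega>. Z i \<omega> \<bullet> Z i \<omega>) \<le> v"
      using fin v by (simp add: nn_integral_eq_integral[OF 1])
  qed
  have off: "integrable M (\<lambda>\<omega>. Z i \<omega> \<bullet> Z j \<omega>)" "expectation (\<lambda>\<omega>. Z i \<omega> \<bullet> Z j \<omega>) = 0"
    if "i \<in> I" "j \<in> I" "i \<noteq> j" for i j
  proof -
    \<comment> \<open>Restricting the family to the disjoint index sets \<open>{i}\<close> and \<open>{j}\<close> isolates the pair.\<close>
    have "indep_var borel ((\<lambda>z. z i) \<circ> (\<lambda>\<omega>. \<lambda>k\<in>{i}. Z k \<omega>))
        borel ((\<lambda>z. z j) \<circ> (\<lambda>\<omega>. \<lambda>k\<in>{j}. Z k \<omega>))"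
      using that by (intro indep_var_compose[OF indep_var_restrict[OF indep]]) auto
    then have "indep_var borel (Z i) borel (Z j)"
      by (simp add: comp_def)
    from expectation_inner_indep[OF this int int] that mean
    show "integrable M (\<lambda>\<omega>. Z i \<omega> \<bullet> Z j \<omega>)" "expectation (\<lambda>\<omega>. Z i \<omega> \<bullet> Z j \<omega>) = 0"
      by auto
  qed
  have int2: "integrable M (\<lambda>\<omega>. Z i \<omega> \<bullet> Z j \<omega>)" if "i \<in> I" "j \<in> I" for i j
    using sq(1) off(1) that by (cases "i = j") auto
  have eq: "(norm (\<Sum>i\<in>I. Z i \<omega>))\<^sup>2 = (\<Sum>i\<in>I. \<Sum>j\<in>I. Z i \<omega> \<bullet> Z j \<omega>)" for \<omega>
    by (simp add: power2_norm_eq_inner inner_sum_left inner_sum_right) (rule sum.swap)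
  have "expectation (\<lambda>\<omega>. \<Sum>i\<in>I. \<Sum>j\<in>I. Z i \<omega> \<bullet> Z j \<omega>)
      = (\<Sum>i\<in>I. \<Sum>j\<in>I. expectation (\<lambda>\<omega>. Z i \<omega> \<bullet> Z j \<omega>))"
    using int2 by simp
  also have "\<dots> = (\<Sum>i\<in>I. expectation (\<lambda>\<omega>. Z i \<omega> \<bullet> Z i \<omega>))"
  proof (rule sum.cong[OF refl])
    fix i assume i: "i \<in> I"
    have "(\<Sum>j\<in>I. expectation (\<lambda>\<omega>. Z i \<omega> \<bullet> Z j \<omega>))
        = (\<Sum>j\<in>I. if i = j then expectation (\<lambda>\<omega>. Z i \<omega> \<bullet> Z i \<omega>) else 0)"
      using off(2) i by (intro sum.cong) auto
    then show "(\<Sum>j\<in>I. expectation (\<lambda>\<omega>. Z i \<omega> \<bullet> Z j \<omega>)) = expectation (\<lambda>\<omega>. Z i \<omega> \<bullet> Z i \<omega>)"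
      using I i by simp
  qed
  also have "\<dots> \<le> real (card I) * v"
    using sq(2) by (rule sum_bounded_above)
  finally have "expectation (\<lambda>\<omega>. (norm (\<Sum>i\<in>I. Z i \<omega>))\<^sup>2) \<le> real (card I) * v"
    by (simp add: eq)
  moreover have "integrable M (\<lambda>\<omega>. (norm (\<Sum>i\<in>I. Z i \<omega>))\<^sup>2)"
    unfolding eq using int2 by auto
  ultimately show ?thesis
    by (simp add: nn_integral_eq_integral ennreal_leI)
qed

text \<open>
  Jensen's inequality for the square, in the form that the variance of \<open>\<parallel>X\<parallel>\<close> is nonnegative.
\<close>

lemma (in prob_space) expectation_norm_le:
  fixes X :: "'a \<Rightarrow> 'b::euclidean_space"
  assumes [measurable]: "X \<in> borel_measurable M"
    and bound: "(\<integral>\<^sup>+ \<omega>. ennreal ((norm (X \<omega>))\<^sup>2) \<partial>M) \<le> ennreal (v\<^sup>2)" and v: "0 \<le> v"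
  shows "integrable M X" and "expectation (\<lambda>\<omega>. norm (X \<omega>)) \<le> v"
proof -
  have sq: "integrable M (\<lambda>\<omega>. (norm (X \<omega>))\<^sup>2)"
    using bound by (intro integrableI_nonneg) (auto simp: le_less_trans)
  then have int: "integrable M (\<lambda>\<omega>. norm (X \<omega>))"
    by (rule square_integrable_imp_integrable[rotated]) simp
  then show "integrable M X"
    by (simp add: integrable_norm_iff)
  have "(expectation (\<lambda>\<omega>. norm (X \<omega>)))\<^sup>2 \<le> expectation (\<lambda>\<omega>. (norm (X \<omega>))\<^sup>2)"
    using variance_eq[OF int sq] variance_positive[of "\<lambda>\<omega>. norm (X \<omega>)"] by simp
  also have "\<dots> \<le> v\<^sup>2"
    using bound by (simp add: nn_integral_eq_integral[OF sq])
  finally show "expectation (\<lambda>\<omega>. norm (X \<omega>)) \<le> v"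
    using v by (rule power2_le_imp_le)
qed

lemma minibatch_gradient_measurable:
  fixes G :: "'s \<Rightarrow> 'a::euclidean_space \<Rightarrow> 'a"
  assumes [measurable]: "(\<lambda>(s, V). G s V) \<in> borel_measurable (D \<Otimes>\<^sub>M borel)"
    and \<xi>[measurable]: "\<And>i. i \<in> {1..b} \<Longrightarrow> (\<lambda>\<omega>. \<xi> \<omega> i) \<in> measurable \<Omega> D"
    and V[measurable]: "V \<in> borel_measurable \<Omega>"
  shows "(\<lambda>\<omega>. minibatch_gradient G b (\<xi> \<omega>) (V \<omega>)) \<in> borel_measurable \<Omega>"
proof -
  have "(\<lambda>\<omega>. G (\<xi> \<omega> i) (V \<omega>)) \<in> borel_measurable \<Omega>" if "i \<in> {1..b}" for i
    using measurable_compose[OF measurable_Pair[OF \<xi>[OF that] V] assms(1)] by simp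
  then show ?thesis
    unfolding minibatch_gradient_def by measurable
qed

text \<open>
  At a fixed point \<open>U\<close> the error is the average of \<open>b\<close> independent centred samples with variance at
  most \<open>\<sigma>\<^sup>2\<close>, so its second moment is at most \<open>\<sigma>\<^sup>2 / b\<close>.  Independence of the batch from \<open>V\<close>
  lets the random point \<open>V\<close> take the place of \<open>U\<close>.
\<close>

lemma (in prob_space) minibatch_gradient_error:
  fixes G :: "'s \<Rightarrow> 'b::euclidean_space \<Rightarrow> 'b"
  assumes D: "prob_space D"
    and G_measurable: "(\<lambda>(s, V). G s V) \<in> borel_measurable (D \<Otimes>\<^sub>M borel)"
    and G_integrable: "\<And>V. integrable D (\<lambda>s. G s V)"
    and variance: "\<And>V. total_variance D (\<lambda>s. G s V) \<le> ennreal (\<sigma>\<^sup>2)" and \<sigma>: "\<sigma> \<ge> 0"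
    and b: "b > 0"
    and \<xi>_indep: "indep_vars (\<lambda>_. D) \<xi> {1..b}"
    and \<xi>_distr: "\<And>i. i \<in> {1..b} \<Longrightarrow> distr M D (\<xi> i) = D"
    and \<xi>_indep_V: "independent_rvs M borel V (\<Pi>\<^sub>M i\<in>{1..b}. D) (\<lambda>\<omega>. \<lambda>i\<in>{1..b}. \<xi> i \<omega>)"
  defines "err \<equiv> \<lambda>\<omega>. minibatch_gradient G b (\<lambda>i. \<xi> i \<omega>) (V \<omega>) - (\<integral>s. G s (V \<omega>) \<partial>D)"
  shows "integrable M err" and "expectation (\<lambda>\<omega>. norm (err \<omega>)) \<le> \<sigma> / sqrt (real b)"
proof -
  interpret D: prob_space D by fact
  note [measurable] = G_measurable
  define \<mu> where "\<mu> V = (\<integral>s. G s V \<partial>D)" for V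
  have [measurable]: "\<mu> \<in> borel_measurable borel"
    unfolding \<mu>_def by measurable
  have \<xi>[measurable]: "\<xi> i \<in> measurable M D" if "i \<in> {1..b}" for i
    using \<xi>_indep that by (auto simp: indep_vars_def)
  have V[measurable]: "V \<in> borel_measurable M"
    using \<xi>_indep_V by (auto simp: independent_rvs_def)
  have GV[measurable]: "(\<lambda>s. G s U) \<in> borel_measurable D" for U
    using G_integrable[of U] by auto

  define h where "h = (\<lambda>(U, x). minibatch_gradient G b x U - \<mu> U)"
  have h[measurable]: "h \<in> borel_measurable (borel \<Otimes>\<^sub>M (\<Pi>\<^sub>M i\<in>{1..b}. D))"
  proof -
    have "(\<lambda>z. minibatch_gradient G b (snd z) (fst z))
        \<in> borel_measurable (borel \<Otimes>\<^sub>M (\<Pi>\<^sub>M i\<in>{1..b}. D))"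
      by (rule minibatch_gradient_measurable[OF G_measurable]) measurable
    then show ?thesis
      unfolding h_def case_prod_beta by measurable
  qed
  let ?\<xi> = "\<lambda>\<omega>. \<lambda>i\<in>{1..b}. \<xi> i \<omega>"
  have err: "err \<omega> = h (V \<omega>, ?\<xi> \<omega>)" for \<omega>
    by (simp add: err_def h_def \<mu>_def minibatch_gradient_def)
  have fixed: "(\<integral>\<^sup>+ \<omega>. ennreal ((norm (h (U, ?\<xi> \<omega>)))\<^sup>2) \<partial>M) \<le> ennreal ((\<sigma> / sqrt (real b))\<^sup>2)" for U
  proof -
    define Z where "Z i \<omega> = G (\<xi> i \<omega>) U - \<mu> U" for i \<omega>
    have "(\<integral>\<^sup>+ \<omega>. ennreal ((norm (\<Sum>i\<in>{1..b}. Z i \<omega>))\<^sup>2) \<partial>M) \<le> ennreal (real (card {1..b}) * \<sigma>\<^sup>2)"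
    proof (rule second_moment_sum_indep)
      show "indep_vars (\<lambda>_. borel) Z {1..b}"
        unfolding Z_def by (rule indep_vars_compose2[OF \<xi>_indep]) measurable
      fix i assume i: "i \<in> {1..b}"
      have int: "integrable M (\<lambda>\<omega>. G (\<xi> i \<omega>) U)"
        using G_integrable[of U] \<xi>[OF i]
        by (subst integrable_distr_eq[symmetric, where N=D]) (auto simp: \<xi>_distr[OF i])
      then show "integrable M (Z i)"
        by (simp add: Z_def[abs_def])
      have "expectation (\<lambda>\<omega>. G (\<xi> i \<omega>) U) = \<mu> U"
        using \<xi>[OF i] by (subst integral_distr[symmetric, where N=D]) (auto simp: \<xi>_distr[OF i] \<mu>_def)
      with int show "expectation (Z i) = 0"
        by (simp add: Z_def[abs_def] prob_space)
      have "(\<integral>\<^sup>+ \<omega>. ennreal ((norm (Z i \<omega>))\<^sup>2) \<partial>M)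
          = (\<integral>\<^sup>+ s. ennreal ((norm (G s U - \<mu> U))\<^sup>2) \<partial>distr M D (\<xi> i))"
        using \<xi>[OF i] by (subst nn_integral_distr) (auto simp: Z_def)
      also have "\<dots> = total_variance D (\<lambda>s. G s U)"
        by (simp add: \<xi>_distr[OF i] total_variance_def \<mu>_def)
      finally show "(\<integral>\<^sup>+ \<omega>. ennreal ((norm (Z i \<omega>))\<^sup>2) \<partial>M) \<le> ennreal (\<sigma>\<^sup>2)"
        using variance by simp
    qed simp_all
    moreover have "(norm (h (U, ?\<xi> \<omega>)))\<^sup>2 = (1 / real b)\<^sup>2 * (norm (\<Sum>i\<in>{1..b}. Z i \<omega>))\<^sup>2" for \<omega>
    proof -
      have "h (U, ?\<xi> \<omega>) = (1 / real b) *\<^sub>R (\<Sum>i\<in>{1..b}. Z i \<omega>)"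
        using b by (simp add: h_def minibatch_gradient_def Z_def sum_subtractf scaleR_diff_right
            sum_constant_scaleR)
      then show ?thesis
        by (simp add: power_mult_distrib power_divide)
    qed
    ultimately have "(\<integral>\<^sup>+ \<omega>. ennreal ((norm (h (U, ?\<xi> \<omega>)))\<^sup>2) \<partial>M)
        \<le> ennreal ((1 / real b)\<^sup>2) * ennreal (real b * \<sigma>\<^sup>2)"
      by (simp add: ennreal_mult nn_integral_cmult Z_def mult_left_mono)
    also have "\<dots> = ennreal ((\<sigma> / sqrt (real b))\<^sup>2)"
      using b by (simp add: ennreal_mult[symmetric] power_divide) (simp add: power2_eq_square)
    finally show ?thesis .
  qed
  have rv: "err \<in> borel_measurable M"
    unfolding err using \<xi>_indep_V
    by (intro measurable_compose[OF measurable_Pair h]) (auto simp: independent_rvs_def)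
  have "(\<integral>\<^sup>+ \<omega>. ennreal ((norm (err \<omega>))\<^sup>2) \<partial>M) \<le> ennreal ((\<sigma> / sqrt (real b))\<^sup>2)"
    unfolding err
  proof (rule nn_integral_independent[OF \<xi>_indep_V, where h = "\<lambda>z. ennreal ((norm (h z))\<^sup>2)"])
    show "(\<lambda>z. ennreal ((norm (h z))\<^sup>2)) \<in> borel_measurable (borel \<Otimes>\<^sub>M (\<Pi>\<^sub>M i\<in>{1..b}. D))"
      by measurable
  qed (rule fixed)
  from expectation_norm_le[OF rv this] \<sigma>
  show "integrable M err" and "expectation (\<lambda>\<omega>. norm (err \<omega>)) \<le> \<sigma> / sqrt (real b)"
    by auto
qed

section \<open>The Muon iteration\<close>

text \<open>
  The direction error \<open>d = \<parallel>C - \<nabla>f(V)\<parallel>\<close> enters twice: once with factor \<open>1\<close> when \<open>\<nabla>f(V)\<close> is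
  replaced by \<open>C\<close> in the norm, and once with factor \<open>sqrt n\<close> when \<open>C\<close> is replaced by \<open>\<nabla>f(V)\<close>
  in the inner product with \<open>X\<close>.  Both are absorbed in \<open>2 sqrt n d\<close>.
\<close>

lemma muon_step:
  fixes f :: "real ^ 'n ^ 'm \<Rightarrow> real"
  assumes smooth: "smooth_with L f" and orth: "is_orthogonalization C X" and \<eta>: "0 \<le> \<eta>"
  shows "\<eta> * norm (gradient f V) \<le> f V - f (V - \<eta> *\<^sub>R X)
      + real CARD('n) * L / 2 * \<eta>\<^sup>2 + 2 * sqrt (real CARD('n)) * (\<eta> * norm (C - gradient f V))"
proof -
  let ?n = "real CARD('n)" and ?d = "norm (C - gradient f V)"
  have X: "norm X = sqrt ?n"
    using orth by (intro norm_orthonormal_columns orthogonalization_columns)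
  have "norm (gradient f V) \<le> norm C + ?d"
    by (metis norm_minus_commute norm_triangle_sub)
  also have "norm C \<le> X \<bullet> C"
    using orth by (rule norm_le_inner_orthogonalization)
  also have "X \<bullet> C = X \<bullet> gradient f V + X \<bullet> (C - gradient f V)"
    by (simp add: inner_diff_right)
  also have "X \<bullet> (C - gradient f V) \<le> sqrt ?n * ?d"
    using norm_cauchy_schwarz[of X] by (simp add: X)
  finally have "norm (gradient f V) \<le> X \<bullet> gradient f V + sqrt ?n * ?d + ?d"
    by simp
  moreover have "?d \<le> sqrt ?n * ?d"
  proof -
    have "1 \<le> sqrt ?n"
      by (simp add: Suc_leI)
    then have "1 * ?d \<le> sqrt ?n * ?d"
      by (intro mult_right_mono) auto
    then show ?thesis
      by simp
  qed
  ultimately have "\<eta> * norm (gradient f V) \<le> \<eta> * (X \<bullet> gradient f V + 2 * (sqrt ?n * ?d))"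
    using \<eta> by (intro mult_left_mono) auto
  moreover have "f (V - \<eta> *\<^sub>R X) \<le> f V - \<eta> * (X \<bullet> gradient f V) + L / 2 * (\<eta>\<^sup>2 * ?n)"
    using descent_lemma[OF smooth, of "V - \<eta> *\<^sub>R X" V]
    by (simp add: X power_mult_distrib inner_commute)
  ultimately show ?thesis
    by (simp add: algebra_simps)
qed

text \<open>
  The direction \<open>C\<close> is left arbitrary, so that both variants of the momentum are instances.
\<close>

locale muon_iteration = prob_space \<Omega>
  for \<Omega> :: "'w measure" +
  fixes f :: "real ^ 'n ^ 'm \<Rightarrow> real"
    and L :: real
    and \<eta> :: "nat \<Rightarrow> real"
    and W0 :: "real ^ 'n ^ 'm"
    and W C Orth :: "nat \<Rightarrow> 'w \<Rightarrow> real ^ 'n ^ 'm"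
  assumes smooth: "smooth_with L f"
    and W_measurable[measurable]: "\<And>t. W t \<in> borel_measurable \<Omega>"
    and \<eta>: "\<And>t. 0 < \<eta> t"
    and W_0: "\<And>\<omega>. \<omega> \<in> space \<Omega> \<Longrightarrow> W 0 \<omega> = W0"
    and Orth: "\<And>t \<omega>. \<omega> \<in> space \<Omega> \<Longrightarrow> is_orthogonalization (C t \<omega>) (Orth t \<omega>)"
    and W_Suc: "\<And>t \<omega>. \<omega> \<in> space \<Omega> \<Longrightarrow> W (Suc t) \<omega> = W t \<omega> - \<eta> t *\<^sub>R Orth t \<omega>"
begin

lemma norm_W_diff:
  assumes "\<omega> \<in> space \<Omega>"
  shows "norm (W t \<omega> - W (Suc t) \<omega>) = sqrt (real CARD('n)) * \<eta> t"
  using norm_orthonormal_columns[OF orthogonalization_columns[OF Orth[OF assms]], of t] \<eta>[of t]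
  by (simp add: W_Suc[OF assms])

lemma W_in_cball:
  assumes "\<omega> \<in> space \<Omega>"
  shows "W t \<omega> \<in> cball W0 (sqrt (real CARD('n)) * (\<Sum>s<t. \<eta> s))"
proof (induction t)
  case (Suc t)
  have "dist W0 (W (Suc t) \<omega>) \<le> dist W0 (W t \<omega>) + dist (W t \<omega>) (W (Suc t) \<omega>)"
    by (rule dist_triangle)
  also have "dist (W t \<omega>) (W (Suc t) \<omega>) = sqrt (real CARD('n)) * \<eta> t"
    using norm_W_diff[OF assms] by (simp add: dist_norm)
  finally show ?case
    using Suc by (simp add: algebra_simps)
qed (simp add: W_0 assms)

text \<open>
  The step lengths are deterministic, so \<open>W t\<close> lies in a compact ball that depends on \<open>t\<close> only, and
  a continuous function is bounded there.
\<close>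

lemma integrable_continuous_W:
  fixes h :: "real ^ 'n ^ 'm \<Rightarrow> 'b::euclidean_space"
  assumes h: "continuous_on UNIV h"
  shows "integrable \<Omega> (\<lambda>\<omega>. h (W t \<omega>))"
proof -
  have "compact (h ` cball W0 (sqrt (real CARD('n)) * (\<Sum>s<t. \<eta> s)))"
    using h by (intro compact_continuous_image) (auto intro: continuous_on_subset)
  then have "bounded (h ` cball W0 (sqrt (real CARD('n)) * (\<Sum>s<t. \<eta> s)))"
    by (rule compact_imp_bounded)
  then obtain B where "\<forall>y\<in>h ` cball W0 (sqrt (real CARD('n)) * (\<Sum>s<t. \<eta> s)). norm y \<le> B"
    unfolding bounded_iff by (elim exE)
  then have B: "norm (h (W t \<omega>)) \<le> B" if "\<omega> \<in> space \<Omega>" for \<omega>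
    using W_in_cball[OF that, of t] by (simp del: mem_cball)
  have [measurable]: "h \<in> borel_measurable borel"
    using h by (rule borel_measurable_continuous_onI)
  show ?thesis
    by (rule integrable_const_bound[where B = B]) (auto intro!: AE_I2 B)
qed

lemma integrable_f_W: "integrable \<Omega> (\<lambda>\<omega>. f (W t \<omega>))"
  by (rule integrable_continuous_W[OF continuous_on_smooth_with[OF smooth]])

lemma integrable_gradient_W: "integrable \<Omega> (\<lambda>\<omega>. gradient f (W t \<omega>))"
  by (rule integrable_continuous_W[OF continuous_on_gradient[OF smooth]])

text \<open>
  The minimum is at most the average weighted by \<open>\<eta>\<close>.  In the sum of the one-step bounds the
  expected values of \<open>f\<close> telescope, and the last one is bounded below by the infimum.
\<close>

lemma min_expected_gradient_norm_le:
  assumes bdd: "bdd_below (range f)"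
    and int: "\<And>t. integrable \<Omega> (\<lambda>\<omega>. C t \<omega> - gradient f (W t \<omega>))"
    and a: "\<And>t. expectation (\<lambda>\<omega>. norm (C t \<omega> - gradient f (W t \<omega>))) \<le> a t"
    and T: "T \<ge> 1"
  shows "(MIN t\<in>{..<T}. expectation (\<lambda>\<omega>. norm (gradient f (W t \<omega>))))
    \<le> (f W0 - (INF V. f V)) / (\<Sum>t<T. \<eta> t)
      + real CARD('n) * L / 2 * ((\<Sum>t<T. (\<eta> t)\<^sup>2) / (\<Sum>t<T. \<eta> t))
      + 2 * sqrt (real CARD('n)) * ((\<Sum>t<T. \<eta> t * a t) / (\<Sum>t<T. \<eta> t))"
proof -
  let ?n = "real CARD('n)" and ?S = "\<Sum>t<T. \<eta> t"
  define E where "E t = expectation (\<lambda>\<omega>. norm (gradient f (W t \<omega>)))" for t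
  define F where "F t = expectation (\<lambda>\<omega>. f (W t \<omega>))" for t
  have S: "0 < ?S"
    using T \<eta> by (intro sum_pos) (auto simp: lessThan_empty_iff)
  have step: "\<eta> t * E t \<le> F t - F (Suc t) + ?n * L / 2 * (\<eta> t)\<^sup>2 + 2 * sqrt ?n * (\<eta> t * a t)" for t
  proof -
    let ?d = "\<lambda>\<omega>. norm (C t \<omega> - gradient f (W t \<omega>))"
    have "\<eta> t * E t = expectation (\<lambda>\<omega>. \<eta> t * norm (gradient f (W t \<omega>)))"
      by (simp add: E_def)
    also have "\<dots> \<le> expectation (\<lambda>\<omega>. f (W t \<omega>) - f (W (Suc t) \<omega>) + ?n * L / 2 * (\<eta> t)\<^sup>2
        + 2 * sqrt ?n * (\<eta> t * ?d \<omega>))"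
    proof (rule integral_mono)
      fix \<omega> assume "\<omega> \<in> space \<Omega>"
      then show "\<eta> t * norm (gradient f (W t \<omega>)) \<le> f (W t \<omega>) - f (W (Suc t) \<omega>)
          + ?n * L / 2 * (\<eta> t)\<^sup>2 + 2 * sqrt ?n * (\<eta> t * ?d \<omega>)"
        using muon_step[OF smooth Orth less_imp_le[OF \<eta>]] by (simp add: W_Suc)
    qed (simp_all add: integrable_f_W integrable_gradient_W integrable_norm[OF int])
    also have "\<dots> = F t - F (Suc t) + ?n * L / 2 * (\<eta> t)\<^sup>2 + 2 * sqrt ?n * (\<eta> t * expectation ?d)"
      using integrable_f_W[of t] integrable_f_W[of "Suc t"] integrable_norm[OF int[of t]]
      by (simp add: F_def prob_space)
    also have "\<dots> \<le> F t - F (Suc t) + ?n * L / 2 * (\<eta> t)\<^sup>2 + 2 * sqrt ?n * (\<eta> t * a t)"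
      using a \<eta>[of t] by (intro add_left_mono mult_left_mono) auto
    finally show ?thesis .
  qed
  have F0: "F 0 = f W0"
    using W_0 by (simp add: F_def prob_space cong: Bochner_Integration.integral_cong)
  have FT: "(INF V. f V) \<le> F T"
    unfolding F_def using bdd
    by (intro integral_ge_const integrable_f_W AE_I2 cINF_lower) auto
  have "(MIN t\<in>{..<T}. E t) * ?S \<le> (\<Sum>t<T. \<eta> t * E t)"
    unfolding sum_distrib_left
  proof (rule sum_mono)
    fix t assume "t \<in> {..<T}"
    then have "(MIN t\<in>{..<T}. E t) \<le> E t"
      by (intro Min_le) auto
    then show "(MIN t\<in>{..<T}. E t) * \<eta> t \<le> \<eta> t * E t"
      using \<eta>[of t] by (simp add: mult.commute)
  qed
  also have "\<dots> \<le> (\<Sum>t<T. F t - F (Suc t) + ?n * L / 2 * (\<eta> t)\<^sup>2 + 2 * sqrt ?n * (\<eta> t * a t))"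
    by (intro sum_mono step)
  also have "\<dots> = F 0 - F T + ?n * L / 2 * (\<Sum>t<T. (\<eta> t)\<^sup>2) + 2 * sqrt ?n * (\<Sum>t<T. \<eta> t * a t)"
    by (simp only: sum.distrib sum_lessThan_telescope' sum_distrib_left)
  also have "\<dots> \<le> f W0 - (INF V. f V)
      + ?n * L / 2 * (\<Sum>t<T. (\<eta> t)\<^sup>2) + 2 * sqrt ?n * (\<Sum>t<T. \<eta> t * a t)"
    using F0 FT by simp
  finally have "(MIN t\<in>{..<T}. E t) \<le> (f W0 - (INF V. f V)
      + ?n * L / 2 * (\<Sum>t<T. (\<eta> t)\<^sup>2) + 2 * sqrt ?n * (\<Sum>t<T. \<eta> t * a t)) / ?S"
    by (simp add: pos_le_divide_eq[OF S])
  then show ?thesis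
    by (simp only: E_def[symmetric] add_divide_distrib times_divide_eq_right)
qed

end

text \<open>
  Unrolling leaves no noise term for \<open>i = t\<close>, since the initial error is accounted for by \<open>x 0\<close>.
  The last sum nevertheless runs up to \<open>t\<close>: the surplus term is nonnegative because \<open>0 \<le> s 0\<close>.
\<close>

lemma momentum_recursion_bound:
  fixes x \<eta> s :: "nat \<Rightarrow> real"
  assumes \<beta>: "0 \<le> \<beta>" "\<beta> < 1" and s: "0 \<le> s 0"
    and rec: "\<And>t. x (Suc t) \<le> \<beta> * x t + \<beta> * r * \<eta> t + (1 - \<beta>) * s (Suc t)"
  shows "x t \<le> \<beta> ^ t * x 0 + r * (\<Sum>i=1..t. \<beta> ^ i * \<eta> (t - i))
    + (1 - \<beta>) * (\<Sum>i=0..t. \<beta> ^ i * s (t - i))"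
proof (induction t)
  case 0
  show ?case
    using \<beta> s by simp
next
  case (Suc t)
  have \<eta>_sum: "(\<Sum>i=1..Suc t. \<beta> ^ i * \<eta> (Suc t - i)) = \<beta> * \<eta> t + \<beta> * (\<Sum>i=1..t. \<beta> ^ i * \<eta> (t - i))"
    by (simp add: sum.atLeast_Suc_atMost[of 0 t] sum.shift_bounds_cl_Suc_ivl sum_distrib_left mult_ac
        del: sum.cl_ivl_Suc)
  have s_sum: "(\<Sum>i=0..Suc t. \<beta> ^ i * s (Suc t - i)) = s (Suc t) + \<beta> * (\<Sum>i=0..t. \<beta> ^ i * s (t - i))"
    by (simp add: sum.atLeast0_atMost_Suc_shift sum_distrib_left mult_ac del: sum.cl_ivl_Suc)
  have "x (Suc t) \<le> \<beta> * (\<beta> ^ t * x 0 + r * (\<Sum>i=1..t. \<beta> ^ i * \<eta> (t - i))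
      + (1 - \<beta>) * (\<Sum>i=0..t. \<beta> ^ i * s (t - i))) + \<beta> * r * \<eta> t + (1 - \<beta>) * s (Suc t)"
    using rec[of t] mult_left_mono[OF Suc \<beta>(1)] by linarith
  also have "\<dots> = \<beta> ^ Suc t * x 0 + r * (\<Sum>i=1..Suc t. \<beta> ^ i * \<eta> (Suc t - i))
      + (1 - \<beta>) * (\<Sum>i=0..Suc t. \<beta> ^ i * s (Suc t - i))"
    unfolding \<eta>_sum s_sum by (simp add: algebra_simps)
  finally show ?case .
qed

context muon_iteration
begin

text \<open>
  The error of the momentum is \<open>\<beta>\<close> times the previous error, plus \<open>\<beta>\<close> times the drift of the
  gradient over one step, plus \<open>1 - \<beta>\<close> times the fresh noise.  The triangle inequality turns this
  into a scalar recursion for the expected norms.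
\<close>

lemma momentum_error:
  fixes M g :: "nat \<Rightarrow> 'w \<Rightarrow> real ^ 'n ^ 'm" and s :: "nat \<Rightarrow> real"
  assumes \<beta>: "0 \<le> \<beta>" "\<beta> < 1"
    and M: "\<And>t \<omega>. \<omega> \<in> space \<Omega> \<Longrightarrow>
      M t \<omega> = \<beta> *\<^sub>R (if t = 0 then 0 else M (t - 1) \<omega>) + (1 - \<beta>) *\<^sub>R g t \<omega>"
    and int: "\<And>t. integrable \<Omega> (\<lambda>\<omega>. g t \<omega> - gradient f (W t \<omega>))"
    and s: "\<And>t. expectation (\<lambda>\<omega>. norm (g t \<omega> - gradient f (W t \<omega>))) \<le> s t"
  shows "integrable \<Omega> (\<lambda>\<omega>. M t \<omega> - gradient f (W t \<omega>))"
    and "expectation (\<lambda>\<omega>. norm (M t \<omega> - gradient f (W t \<omega>)))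
      \<le> \<beta> ^ t * expectation (\<lambda>\<omega>. norm (M 0 \<omega> - gradient f W0))
        + L * sqrt (real CARD('n)) * (\<Sum>i=1..t. \<beta> ^ i * \<eta> (t - i))
        + (1 - \<beta>) * (\<Sum>i=0..t. \<beta> ^ i * s (t - i))"
proof -
  let ?n = "real CARD('n)"
  define e where "e t \<omega> = M t \<omega> - gradient f (W t \<omega>)" for t \<omega>
  define \<delta> where "\<delta> t \<omega> = g t \<omega> - gradient f (W t \<omega>)" for t \<omega>
  define \<Delta> where "\<Delta> t \<omega> = gradient f (W t \<omega>) - gradient f (W (Suc t) \<omega>)" for t \<omega>
  have \<delta>: "integrable \<Omega> (\<delta> t)" for t
    using int by (simp add: \<delta>_def[abs_def])
  have \<Delta>: "integrable \<Omega> (\<Delta> t)" for t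
    using integrable_gradient_W by (simp add: \<Delta>_def[abs_def])
  have \<Delta>_le: "norm (\<Delta> t \<omega>) \<le> L * sqrt ?n * \<eta> t" if "\<omega> \<in> space \<Omega>" for t \<omega>
  proof -
    have "norm (\<Delta> t \<omega>) \<le> L * norm (W t \<omega> - W (Suc t) \<omega>)"
      using smooth unfolding smooth_with_def \<Delta>_def by blast
    then show ?thesis
      by (simp add: norm_W_diff[OF that])
  qed
  \<comment> \<open>The initial error includes a bias, because the momentum starts at zero.\<close>
  have e_0: "e 0 \<omega> = (1 - \<beta>) *\<^sub>R \<delta> 0 \<omega> - \<beta> *\<^sub>R gradient f (W 0 \<omega>)" if "\<omega> \<in> space \<Omega>" for \<omega>
    using M[OF that, of 0] by (simp add: e_def \<delta>_def algebra_simps)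
  have e_Suc: "e (Suc t) \<omega> = \<beta> *\<^sub>R e t \<omega> + \<beta> *\<^sub>R \<Delta> t \<omega> + (1 - \<beta>) *\<^sub>R \<delta> (Suc t) \<omega>"
    if "\<omega> \<in> space \<Omega>" for t \<omega>
    using M[OF that, of "Suc t"] by (simp add: e_def \<delta>_def \<Delta>_def algebra_simps)
  have e: "integrable \<Omega> (e t)" for t
  proof (induction t)
    case 0
    have "integrable \<Omega> (\<lambda>\<omega>. (1 - \<beta>) *\<^sub>R \<delta> 0 \<omega> - \<beta> *\<^sub>R gradient f (W 0 \<omega>))"
      using \<delta> integrable_gradient_W by auto
    then show ?case
      using e_0 by (simp cong: Bochner_Integration.integrable_cong)
  next
    case (Suc t)
    then have "integrable \<Omega> (\<lambda>\<omega>. \<beta> *\<^sub>R e t \<omega> + \<beta> *\<^sub>R \<Delta> t \<omega> + (1 - \<beta>) *\<^sub>R \<delta> (Suc t) \<omega>)"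
      using \<delta> \<Delta> by auto
    then show ?case
      using e_Suc by (simp cong: Bochner_Integration.integrable_cong)
  qed
  then show "integrable \<Omega> (\<lambda>\<omega>. M t \<omega> - gradient f (W t \<omega>))"
    by (simp add: e_def[abs_def])
  define x where "x t = expectation (\<lambda>\<omega>. norm (e t \<omega>))" for t
  have "x (Suc t) \<le> \<beta> * x t + \<beta> * (L * sqrt ?n) * \<eta> t + (1 - \<beta>) * s (Suc t)" for t
  proof -
    have "x (Suc t) \<le> expectation (\<lambda>\<omega>. \<beta> * norm (e t \<omega>) + \<beta> * (L * sqrt ?n) * \<eta> t
        + (1 - \<beta>) * norm (\<delta> (Suc t) \<omega>))"
      unfolding x_def
    proof (rule integral_mono)
      fix \<omega> assume \<omega>: "\<omega> \<in> space \<Omega>"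
      have "norm (e (Suc t) \<omega>)
          \<le> norm (\<beta> *\<^sub>R e t \<omega>) + norm (\<beta> *\<^sub>R \<Delta> t \<omega>) + norm ((1 - \<beta>) *\<^sub>R \<delta> (Suc t) \<omega>)"
        unfolding e_Suc[OF \<omega>] by (intro norm_triangle_le add_right_mono norm_triangle_ineq)
      also have "norm (\<beta> *\<^sub>R \<Delta> t \<omega>) \<le> \<beta> * (L * sqrt ?n * \<eta> t)"
        using \<beta> \<Delta>_le[OF \<omega>] by (simp add: mult_left_mono)
      finally show "norm (e (Suc t) \<omega>) \<le> \<beta> * norm (e t \<omega>) + \<beta> * (L * sqrt ?n) * \<eta> t
          + (1 - \<beta>) * norm (\<delta> (Suc t) \<omega>)"
        using \<beta> by (simp add: mult_ac)
    qed (use e \<delta> in auto)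
    also have "\<dots> = \<beta> * x t + \<beta> * (L * sqrt ?n) * \<eta> t
        + (1 - \<beta>) * expectation (\<lambda>\<omega>. norm (\<delta> (Suc t) \<omega>))"
      using integrable_norm[OF e] integrable_norm[OF \<delta>] by (simp add: x_def prob_space)
    also have "\<dots> \<le> \<beta> * x t + \<beta> * (L * sqrt ?n) * \<eta> t + (1 - \<beta>) * s (Suc t)"
      using s[of "Suc t"] \<beta> by (intro add_left_mono mult_left_mono) (auto simp: \<delta>_def)
    finally show ?thesis .
  qed
  moreover have "0 \<le> s 0"
    using s[of 0] by (rule order_trans[rotated]) simp
  ultimately have "x t \<le> \<beta> ^ t * x 0 + L * sqrt ?n * (\<Sum>i=1..t. \<beta> ^ i * \<eta> (t - i))
      + (1 - \<beta>) * (\<Sum>i=0..t. \<beta> ^ i * s (t - i))"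
    by (intro momentum_recursion_bound[OF \<beta>])
  moreover have "x 0 = expectation (\<lambda>\<omega>. norm (M 0 \<omega> - gradient f W0))"
    unfolding x_def e_def by (intro Bochner_Integration.integral_cong) (simp_all add: W_0)
  ultimately show "expectation (\<lambda>\<omega>. norm (M t \<omega> - gradient f (W t \<omega>)))
      \<le> \<beta> ^ t * expectation (\<lambda>\<omega>. norm (M 0 \<omega> - gradient f W0))
        + L * sqrt (real CARD('n)) * (\<Sum>i=1..t. \<beta> ^ i * \<eta> (t - i))
        + (1 - \<beta>) * (\<Sum>i=0..t. \<beta> ^ i * s (t - i))"
    by (simp add: x_def e_def)
qed

end

text \<open>
  With Nesterov momentum, the direction error is a convex combination of momentum error and noise.
\<close>

lemma (in prob_space) expectation_norm_convex_combination:
  fixes X Y Z :: "'a \<Rightarrow> 'b::euclidean_space"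
  assumes \<beta>: "0 \<le> \<beta>" "\<beta> < 1"
    and X: "integrable M X" "expectation (\<lambda>\<omega>. norm (X \<omega>)) \<le> x"
    and Y: "integrable M Y" "expectation (\<lambda>\<omega>. norm (Y \<omega>)) \<le> y"
    and Z: "\<And>\<omega>. \<omega> \<in> space M \<Longrightarrow> Z \<omega> = \<beta> *\<^sub>R X \<omega> + (1 - \<beta>) *\<^sub>R Y \<omega>"
  shows "integrable M Z" and "expectation (\<lambda>\<omega>. norm (Z \<omega>)) \<le> \<beta> * x + (1 - \<beta>) * y"
proof -
  have "integrable M (\<lambda>\<omega>. \<beta> *\<^sub>R X \<omega> + (1 - \<beta>) *\<^sub>R Y \<omega>)"
    using X Y by auto
  then show int: "integrable M Z"
    using Z by (simp cong: Bochner_Integration.integrable_cong)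
  have "expectation (\<lambda>\<omega>. norm (Z \<omega>)) \<le> expectation (\<lambda>\<omega>. \<beta> * norm (X \<omega>) + (1 - \<beta>) * norm (Y \<omega>))"
  proof (rule integral_mono)
    fix \<omega> assume "\<omega> \<in> space M"
    then show "norm (Z \<omega>) \<le> \<beta> * norm (X \<omega>) + (1 - \<beta>) * norm (Y \<omega>)"
      using norm_triangle_ineq[of "\<beta> *\<^sub>R X \<omega>" "(1 - \<beta>) *\<^sub>R Y \<omega>"] \<beta> by (simp add: Z)
  qed (use int X Y in auto)
  also have "\<dots> = \<beta> * expectation (\<lambda>\<omega>. norm (X \<omega>)) + (1 - \<beta>) * expectation (\<lambda>\<omega>. norm (Y \<omega>))"
    using X Y by simp
  also have "\<dots> \<le> \<beta> * x + (1 - \<beta>) * y"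
    using X Y \<beta> by (intro add_mono mult_left_mono) auto
  finally show "expectation (\<lambda>\<omega>. norm (Z \<omega>)) \<le> \<beta> * x + (1 - \<beta>) * y" .
qed

section \<open>Convergence of Muon\<close>

lemma bdd_below_average:
  fixes fs :: "nat \<Rightarrow> 'a \<Rightarrow> real"
  assumes "\<And>i. i \<in> {1..N} \<Longrightarrow> bdd_below (range (fs i))"
  shows "bdd_below (range (\<lambda>x. (1 / real N) * (\<Sum>i=1..N. fs i x)))"
proof -
  have "(INF y. fs i y) \<le> fs i x" if "i \<in> {1..N}" for i x
    using assms[OF that] by (rule cINF_lower) simp
  then show ?thesis
    by (intro bdd_belowI2[where m = "(1 / real N) * (\<Sum>i=1..N. INF y. fs i y)"] mult_left_mono
        sum_mono) auto
qed

theorem theorem3p1: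
  fixes N :: nat
    and fs :: "nat \<Rightarrow> real ^ 'n ^ 'm \<Rightarrow> real"
    and f :: "real ^ 'n ^ 'm \<Rightarrow> real"
    and Ls :: "nat \<Rightarrow> real"
    and L fstar \<sigma> \<beta> :: real
    and D :: "'s measure"
    and G :: "'s \<Rightarrow> real ^ 'n ^ 'm \<Rightarrow> real ^ 'n ^ 'm"
    and \<Omega> :: "'w measure"
    and \<xi> :: "nat \<Rightarrow> nat \<Rightarrow> 'w \<Rightarrow> 's"
    and \<eta> :: "nat \<Rightarrow> real"
    and b :: "nat \<Rightarrow> nat"
    and W0 :: "real ^ 'n ^ 'm"
    and W M C Orth g :: "nat \<Rightarrow> 'w \<Rightarrow> real ^ 'n ^ 'm"
    and C1 C2 C3 C4 C5 C6 :: real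
  assumes N: "N \<ge> 1"
    and f: "f = (\<lambda>V. (1 / real N) * (\<Sum>i=1..N. fs i V))"
    and L: "L = (1 / real N) * (\<Sum>i=1..N. Ls i)"
    and fstar: "fstar = (INF V. f V)"
    \<comment> \<open>Assumption (i)\<close>
    and smooth: "\<And>i. i \<in> {1..N} \<Longrightarrow> smooth_with (Ls i) (fs i)"
    and bounded_below: "\<And>i. i \<in> {1..N} \<Longrightarrow> bdd_below (range (fs i))"
    \<comment> \<open>Assumption (ii); \<open>D\<close> is the distribution of the generic sample\<close>
    and D: "prob_space D"
    and G_measurable: "(\<lambda>(s, V). G s V) \<in> borel_measurable (D \<Otimes>\<^sub>M borel)"
    and G_integrable: "\<And>V. integrable D (\<lambda>s. G s V)"
    and unbiased: "\<And>V. (\<integral>s. G s V \<partial>D) = gradient f V"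
    and \<sigma>: "\<sigma> \<ge> 0"
    and variance: "\<And>V. total_variance D (\<lambda>s. G s V) \<le> ennreal (\<sigma>\<^sup>2)"
    \<comment> \<open>The samples drawn by the algorithm\<close>
    and \<Omega>: "prob_space \<Omega>"
    and b: "\<And>t. b t > 0"
    and \<xi>_indep: "\<And>t. prob_space.indep_vars \<Omega> (\<lambda>_. D) (\<xi> t) {1..b t}"
    and \<xi>_distr: "\<And>t i. i \<in> {1..b t} \<Longrightarrow> distr \<Omega> D (\<xi> t i) = D"
    and \<xi>_indep_W: "\<And>t. independent_rvs \<Omega> borel (W t)
          (\<Pi>\<^sub>M i\<in>{1..b t}. D) (\<lambda>\<omega>. \<lambda>i\<in>{1..b t}. \<xi> t i \<omega>)"
    \<comment> \<open>The Muon iteration, up to the choice of \<open>C\<close>\<close>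
    and \<eta>: "\<And>t. \<eta> t > 0"
    and \<beta>: "0 \<le> \<beta>" "\<beta> < 1"
    and W_0: "\<And>\<omega>. \<omega> \<in> space \<Omega> \<Longrightarrow> W 0 \<omega> = W0"
    and g: "\<And>t \<omega>. \<omega> \<in> space \<Omega> \<Longrightarrow>
          g t \<omega> = minibatch_gradient G (b t) (\<lambda>i. \<xi> t i \<omega>) (W t \<omega>)"
    and M: "\<And>t \<omega>. \<omega> \<in> space \<Omega> \<Longrightarrow>
          M t \<omega> = \<beta> *\<^sub>R (if t = 0 then 0 else M (t - 1) \<omega>) + (1 - \<beta>) *\<^sub>R g t \<omega>"
    and Orth: "\<And>t \<omega>. \<omega> \<in> space \<Omega> \<Longrightarrow> is_orthogonalization (C t \<omega>) (Orth t \<omega>)"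
    and W_Suc: "\<And>t \<omega>. \<omega> \<in> space \<Omega> \<Longrightarrow> W (Suc t) \<omega> = W t \<omega> - \<eta> t *\<^sub>R Orth t \<omega>"
    \<comment> \<open>The constants\<close>
    and C1: "C1 = f W0 - fstar"
    and C2: "C2 = real CARD('n) * L / 2"
    and C3: "C3 = 2 * (\<integral>\<omega>. norm (M 0 \<omega> - gradient f W0) \<partial>\<Omega>) * sqrt (real CARD('n))"
    and C4: "C4 = 2 * real CARD('n) * L"
    and C5: "C5 = 2 * (1 - \<beta>) * \<sigma> * sqrt (real CARD('n))"
    and C6: "C6 = 2 * (1 - \<beta>) * \<sigma> * sqrt (real CARD('n))"
  shows
    \<comment> \<open>Without Nesterov\<close>
    "((\<forall>t. \<forall>\<omega>\<in>space \<Omega>. C t \<omega> = M t \<omega>) \<longrightarrow>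
      (\<forall>T\<ge>1.
        (MIN t\<in>{..<T}. \<integral>\<omega>. norm (gradient f (W t \<omega>)) \<partial>\<Omega>)
        \<le> C1 / (\<Sum>t<T. \<eta> t)
          + C2 * ((\<Sum>t<T. (\<eta> t)\<^sup>2) / (\<Sum>t<T. \<eta> t))
          + C3 * ((\<Sum>t<T. \<eta> t * \<beta> ^ t) / (\<Sum>t<T. \<eta> t))
          + C4 * ((\<Sum>t<T. \<eta> t * (\<Sum>i=1..t. \<beta> ^ i * \<eta> (t - i))) / (\<Sum>t<T. \<eta> t))
          + C5 * ((\<Sum>t<T. \<eta> t * (\<Sum>i=0..t. \<beta> ^ i / sqrt (real (b (t - i))))) / (\<Sum>t<T. \<eta> t))))
     \<and>
     ((\<forall>t. \<forall>\<omega>\<in>space \<Omega>. C t \<omega> = \<beta> *\<^sub>R M t \<omega> + (1 - \<beta>) *\<^sub>R g t \<omega>) \<longrightarrow>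
      (\<forall>T\<ge>1.
        (MIN t\<in>{..<T}. \<integral>\<omega>. norm (gradient f (W t \<omega>)) \<partial>\<Omega>)
        \<le> C1 / (\<Sum>t<T. \<eta> t)
          + C2 * ((\<Sum>t<T. (\<eta> t)\<^sup>2) / (\<Sum>t<T. \<eta> t))
          + C3 * ((\<Sum>t<T. \<eta> t * \<beta> ^ (t + 1)) / (\<Sum>t<T. \<eta> t))
          + C4 * ((\<Sum>t<T. \<eta> t * (\<Sum>i=1..t. \<beta> ^ (i + 1) * \<eta> (t - i))) / (\<Sum>t<T. \<eta> t))
          + C5 * ((\<Sum>t<T. \<eta> t * (\<Sum>i=0..t. \<beta> ^ (i + 1) / sqrt (real (b (t - i))))) / (\<Sum>t<T. \<eta> t))
          + C6 * ((\<Sum>t<T. \<eta> t / sqrt (real (b t))) / (\<Sum>t<T. \<eta> t))))"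
proof -
  let ?n = "real CARD('n)"
  let ?E0 = "\<integral>\<omega>. norm (M 0 \<omega> - gradient f W0) \<partial>\<Omega>"
  interpret prob_space \<Omega> by fact
  interpret muon_iteration \<Omega> f L \<eta> W0 W C Orth
  proof
    show "smooth_with L f"
      unfolding f L using N smooth by (rule smooth_with_average)
    show "W t \<in> borel_measurable \<Omega>" for t
      using \<xi>_indep_W[of t] by (simp add: independent_rvs_def)
  qed (fact \<eta> W_0 Orth W_Suc)+
  have bdd: "bdd_below (range f)"
    unfolding f using bounded_below by (rule bdd_below_average)
  define s where "s t = \<sigma> / sqrt (real (b t))" for t
  have noise: "integrable \<Omega> (\<lambda>\<omega>. g t \<omega> - gradient f (W t \<omega>))"
    "expectation (\<lambda>\<omega>. norm (g t \<omega> - gradient f (W t \<omega>))) \<le> s t" for t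
  proof -
    have g_eq: "g t \<omega> = minibatch_gradient G (b t) (\<lambda>i. \<xi> t i \<omega>) (W t \<omega>)" if "\<omega> \<in> space \<Omega>" for \<omega>
      using that by (rule g)
    note * = minibatch_gradient_error[OF D G_measurable G_integrable variance \<sigma> b \<xi>_indep \<xi>_distr
        \<xi>_indep_W, unfolded unbiased]
    from *(1)[of t] show "integrable \<Omega> (\<lambda>\<omega>. g t \<omega> - gradient f (W t \<omega>))"
      by (simp add: g_eq cong: Bochner_Integration.integrable_cong)
    from *(2)[of t] show "expectation (\<lambda>\<omega>. norm (g t \<omega> - gradient f (W t \<omega>))) \<le> s t"
      by (simp add: g_eq s_def cong: Bochner_Integration.integral_cong)
  qed
  define a where "a t = \<beta> ^ t * ?E0 + L * sqrt ?n * (\<Sum>i=1..t. \<beta> ^ i * \<eta> (t - i))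
    + (1 - \<beta>) * (\<Sum>i=0..t. \<beta> ^ i * s (t - i))" for t
  have momentum: "integrable \<Omega> (\<lambda>\<omega>. M t \<omega> - gradient f (W t \<omega>))"
    "expectation (\<lambda>\<omega>. norm (M t \<omega> - gradient f (W t \<omega>))) \<le> a t" for t
    using momentum_error[OF \<beta> M noise] by (simp_all add: a_def)
  note average = min_expected_gradient_norm_le[OF bdd, folded fstar, folded C1 C2]
  have n: "sqrt ?n * sqrt ?n = ?n"
    by simp
  \<comment> \<open>The factor \<open>2 sqrt n\<close> of the one-step bound turns the direction error into the constants.\<close>
  have a_scaled: "2 * sqrt ?n * a t = C3 * \<beta> ^ t + C4 * (\<Sum>i=1..t. \<beta> ^ i * \<eta> (t - i))
      + C5 * (\<Sum>i=0..t. \<beta> ^ i / sqrt (real (b (t - i))))" for t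
  proof -
    have "(\<Sum>i=0..t. \<beta> ^ i * s (t - i)) = \<sigma> * (\<Sum>i=0..t. \<beta> ^ i / sqrt (real (b (t - i))))"
      by (simp add: s_def sum_distrib_left mult_ac)
    then have "2 * sqrt ?n * a t = C3 * \<beta> ^ t
        + 2 * (sqrt ?n * sqrt ?n) * L * (\<Sum>i=1..t. \<beta> ^ i * \<eta> (t - i))
        + C5 * (\<Sum>i=0..t. \<beta> ^ i / sqrt (real (b (t - i))))"
      unfolding a_def C3 C5 by (simp only: distrib_left mult_ac)
    then show ?thesis
      by (simp only: n C4)
  qed
  have scale: "(\<Sum>t<T. \<eta> t * (c * h t)) = c * (\<Sum>t<T. \<eta> t * h t)" for T c and h :: "nat \<Rightarrow> real"
    by (simp add: sum_distrib_left mult.left_commute)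
  show ?thesis
  proof (intro conjI impI allI)
    fix T :: nat
    assume "\<forall>t. \<forall>\<omega>\<in>space \<Omega>. C t \<omega> = M t \<omega>" and T: "1 \<le> T"
    then have C: "C t \<omega> = M t \<omega>" if "\<omega> \<in> space \<Omega>" for t \<omega>
      using that by blast
    have C_err: "integrable \<Omega> (\<lambda>\<omega>. C t \<omega> - gradient f (W t \<omega>))"
      "expectation (\<lambda>\<omega>. norm (C t \<omega> - gradient f (W t \<omega>))) \<le> a t" for t
      using momentum[of t]
      by (simp_all add: C cong: Bochner_Integration.integrable_cong Bochner_Integration.integral_cong)
    have "2 * sqrt ?n * (\<Sum>t<T. \<eta> t * a t)
        = (\<Sum>t<T. \<eta> t * (2 * sqrt ?n * a t))"
      by (simp only: sum_distrib_left mult_ac)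
    also have "\<dots> = C3 * (\<Sum>t<T. \<eta> t * \<beta> ^ t)
        + C4 * (\<Sum>t<T. \<eta> t * (\<Sum>i=1..t. \<beta> ^ i * \<eta> (t - i)))
        + C5 * (\<Sum>t<T. \<eta> t * (\<Sum>i=0..t. \<beta> ^ i / sqrt (real (b (t - i)))))"
      unfolding a_scaled distrib_left sum.distrib
      by (simp only: scale)
    finally show "(MIN t\<in>{..<T}. \<integral>\<omega>. norm (gradient f (W t \<omega>)) \<partial>\<Omega>)
        \<le> C1 / (\<Sum>t<T. \<eta> t)
          + C2 * ((\<Sum>t<T. (\<eta> t)\<^sup>2) / (\<Sum>t<T. \<eta> t))
          + C3 * ((\<Sum>t<T. \<eta> t * \<beta> ^ t) / (\<Sum>t<T. \<eta> t))
          + C4 * ((\<Sum>t<T. \<eta> t * (\<Sum>i=1..t. \<beta> ^ i * \<eta> (t - i))) / (\<Sum>t<T. \<eta> t))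
          + C5 * ((\<Sum>t<T. \<eta> t * (\<Sum>i=0..t. \<beta> ^ i / sqrt (real (b (t - i))))) / (\<Sum>t<T. \<eta> t))"
      using average[OF C_err T] by (simp only: times_divide_eq_right add_divide_distrib add.assoc)
  next
    fix T :: nat
    assume "\<forall>t. \<forall>\<omega>\<in>space \<Omega>. C t \<omega> = \<beta> *\<^sub>R M t \<omega> + (1 - \<beta>) *\<^sub>R g t \<omega>" and T: "1 \<le> T"
    then have C: "C t \<omega> = \<beta> *\<^sub>R M t \<omega> + (1 - \<beta>) *\<^sub>R g t \<omega>" if "\<omega> \<in> space \<Omega>" for t \<omega>
      using that by blast
    define a' where "a' t = \<beta> * a t + (1 - \<beta>) * s t" for t
    have C_err: "integrable \<Omega> (\<lambda>\<omega>. C t \<omega> - gradient f (W t \<omega>))"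
      "expectation (\<lambda>\<omega>. norm (C t \<omega> - gradient f (W t \<omega>))) \<le> a' t" for t
    proof -
      have "C t \<omega> - gradient f (W t \<omega>) = \<beta> *\<^sub>R (M t \<omega> - gradient f (W t \<omega>))
          + (1 - \<beta>) *\<^sub>R (g t \<omega> - gradient f (W t \<omega>))" if "\<omega> \<in> space \<Omega>" for \<omega>
        by (simp add: C[OF that] algebra_simps)
      from expectation_norm_convex_combination[OF \<beta> momentum noise this]
      show "integrable \<Omega> (\<lambda>\<omega>. C t \<omega> - gradient f (W t \<omega>))"
        "expectation (\<lambda>\<omega>. norm (C t \<omega> - gradient f (W t \<omega>))) \<le> a' t"
        by (simp_all add: a'_def)
    qed
    have a'_scaled: "2 * sqrt ?n * a' t = C3 * \<beta> ^ (t + 1)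
        + C4 * (\<Sum>i=1..t. \<beta> ^ (i + 1) * \<eta> (t - i))
        + C5 * (\<Sum>i=0..t. \<beta> ^ (i + 1) / sqrt (real (b (t - i)))) + C6 * (1 / sqrt (real (b t)))" for t
    proof -
      have "2 * sqrt ?n * a' t = \<beta> * (2 * sqrt ?n * a t) + C6 * (1 / sqrt (real (b t)))"
        unfolding a'_def s_def C6 by (simp add: distrib_left mult_ac)
      then show ?thesis
        unfolding a_scaled by (simp add: distrib_left sum_distrib_left mult_ac)
    qed
    have "2 * sqrt ?n * (\<Sum>t<T. \<eta> t * a' t)
        = (\<Sum>t<T. \<eta> t * (2 * sqrt ?n * a' t))"
      by (simp only: sum_distrib_left mult_ac)
    also have "\<dots> = C3 * (\<Sum>t<T. \<eta> t * \<beta> ^ (t + 1))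
        + C4 * (\<Sum>t<T. \<eta> t * (\<Sum>i=1..t. \<beta> ^ (i + 1) * \<eta> (t - i)))
        + C5 * (\<Sum>t<T. \<eta> t * (\<Sum>i=0..t. \<beta> ^ (i + 1) / sqrt (real (b (t - i)))))
        + C6 * (\<Sum>t<T. \<eta> t * (1 / sqrt (real (b t))))"
      unfolding a'_scaled distrib_left sum.distrib
      by (simp only: scale)
    also have "(\<Sum>t<T. \<eta> t * (1 / sqrt (real (b t)))) = (\<Sum>t<T. \<eta> t / sqrt (real (b t)))"
      by simp
    finally show "(MIN t\<in>{..<T}. \<integral>\<omega>. norm (gradient f (W t \<omega>)) \<partial>\<Omega>)
        \<le> C1 / (\<Sum>t<T. \<eta> t)
          + C2 * ((\<Sum>t<T. (\<eta> t)\<^sup>2) / (\<Sum>t<T. \<eta> t))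
          + C3 * ((\<Sum>t<T. \<eta> t * \<beta> ^ (t + 1)) / (\<Sum>t<T. \<eta> t))
          + C4 * ((\<Sum>t<T. \<eta> t * (\<Sum>i=1..t. \<beta> ^ (i + 1) * \<eta> (t - i))) / (\<Sum>t<T. \<eta> t))
          + C5 * ((\<Sum>t<T. \<eta> t * (\<Sum>i=0..t. \<beta> ^ (i + 1) / sqrt (real (b (t - i))))) / (\<Sum>t<T. \<eta> t))
          + C6 * ((\<Sum>t<T. \<eta> t / sqrt (real (b t))) / (\<Sum>t<T. \<eta> t))"
      using average[OF C_err T] by (simp only: times_divide_eq_right add_divide_distrib add.assoc)
  qed
qed

end
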